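(* Let $a>0$, let $\alpha\in\mathbb{C}$ with $|\alpha|=1$, and let $\alpha^*=\overline\alpha$. The location of the point masses of the Clark measure of $L_{1,\alpha}$ (the set of $s\in\mathbb{R}$ with $\mu^{B\alpha^*}(\{s\})\ne0$) is the set $$P_\alpha=\left\{s=\frac1a\tan^{-1}\!\left(\frac{\alpha^*+1}{\alpha^*-1}\tan(ia)\right)+\frac{n\pi}{a}:\ n\in\mathbb{Z}\right\},$$ where the inverse tangent is extended by $\tan^{-1}(\pm\infty)=\pm\pi/2$.
   Context: $L_1=i\frac{d}{dx}$ on $L^2(-a,a)$. The minimal operator $L_{1,\min}$ (absolutely continuous $f\in L^2(-a,a)$ with $f'\in L^2(-a,a)$ and $f(\pm a)=0$) has deficiency indices $(1,1)$, and its self-adjoint extensions $L_{1,\alpha}$ are parametrized by $\alpha\in\mathbb{T}$. Its Livšic characteristic function, constructed from the eigenfunctions $e^{-iwx}$ of $L_1$ on $(-a,a)$, is the scalar contractive analytic function on the upper half-plane $\mathbb{C}^+$ $$B(w)=\frac{w-i}{w+i}\,\frac{\langle e^{-iwx},e^{-x}\rangle}{\langle e^{-iwx},e^{x}\rangle}=\frac{\sin((w-i)a)}{\sin((w+i)a)},$$ where $\langle\cdot,\cdot\rangle$ is the inner product of $L^2(-a,a)$. The Clark measure of $L_{1,\alpha}$ is the measure $\mu^{B\alpha^*}$ on $\mathbb{R}$ defined as follows. Let $\gamma(w)=\frac{w-i}{w+i}$ be the Cayley transform from $\mathbb{C}^+$ onto the unit disk $\mathbb{D}$ (mapping $\mathbb{R}$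 onto $\mathbb{T}\setminus\{1\}$), and $B(w)=b(\gamma(w))$. Then $\mu^{b\alpha^*}$ is the unique nonnegative Borel measure on $\mathbb{T}$ with $\operatorname{Re}\frac{1+b(\zeta)\alpha^*}{1-b(\zeta)\alpha^*}=\int_{\mathbb{T}}\frac{1-|\zeta|^2}{|\lambda-\zeta|^2}\mu^{b\alpha^*}(d\lambda)$ for $\zeta\in\mathbb{D}$, and $\mu^{B\alpha^*}(\Omega)=\int_\Omega\frac{1}{\pi(1+t^2)}(\mu^{b\alpha^*}\circ\gamma)(dt)$ for Borel $\Omega\subseteq\mathbb{R}$, where $(\mu^{b\alpha^*}\circ\gamma)(\Omega)=\mu^{b\alpha^*}(\gamma(\Omega))$. For $\alpha=1$ the argument of $\tan^{-1}$ is interpreted as $\pm\infty$. *)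

theory Defs
  imports "HOL-Analysis.Analysis"
begin

abbreviation upper_half_plane :: "complex set" where
  "upper_half_plane \<equiv> {w. 0 < Im w}"

definition cayley :: "complex \<Rightarrow> complex" where
  "cayley w = (w - \<i>) / (w + \<i>)"

definition L2_inner :: "real \<Rightarrow> (real \<Rightarrow> complex) \<Rightarrow> (real \<Rightarrow> complex) \<Rightarrow> complex" where
  "L2_inner a f g = set_lebesgue_integral lborel {-a<..<a} (\<lambda>x. f x * cnj (g x))"

text \<open>
  The Livsic characteristic function of the minimal operator of \<open>i d/dx\<close> on \<open>L\<^sup>2(-a,a)\<close>.
  Only its values on the upper half-plane are meaningful; there the denominator does not vanish.
\<close>

definition livsic :: "real \<Rightarrow> complex \<Rightarrow> complex" where
  "livsic a w = (w - \<i>) / (w + \<i>) *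
     (L2_inner a (\<lambda>x. exp (- \<i> * w * of_real x)) (\<lambda>x. of_real (exp (- x))) /
      L2_inner a (\<lambda>x. exp (- \<i> * w * of_real x)) (\<lambda>x. of_real (exp x)))"

text \<open>
  The Clark measure of a contractive analytic function \<open>f\<close> on the unit disk, a Borel measure
  whose underlying space is the unit circle. \<open>has_bochner_integral\<close> includes integrability,
  so the defining identity at \<open>\<zeta> = 0\<close> makes the measure finite.
\<close>

definition is_clark_disk :: "(complex \<Rightarrow> complex) \<Rightarrow> complex measure \<Rightarrow> bool" where
  "is_clark_disk f \<mu> \<longleftrightarrow>
     sets \<mu> = sets (restrict_space borel (sphere 0 1)) \<and>
     (\<forall>\<zeta>\<in>ball 0 1. has_bochner_integral \<mu>
        (\<lambda>z. (1 - (cmod \<zeta>)\<^sup>2) / (cmod (z - \<zeta>))\<^sup>2)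
        (Re ((1 + f \<zeta>) / (1 - f \<zeta>))))"

definition clark_disk :: "(complex \<Rightarrow> complex) \<Rightarrow> complex measure" where
  "clark_disk f = (THE \<mu>. is_clark_disk f \<mu>)"

definition cayley_pullback :: "complex measure \<Rightarrow> real measure" where
  "cayley_pullback \<mu> =
     measure_of UNIV (sets borel) (\<lambda>\<Omega>. emeasure \<mu> ((\<lambda>t. cayley (of_real t)) ` \<Omega>))"

text \<open>
  The Clark measure on the real line of a contractive analytic function \<open>F = f \<circ> cayley\<close>
  on the upper half-plane.
\<close>

definition clark_line :: "(complex \<Rightarrow> complex) \<Rightarrow> real measure" where
  "clark_line F =
     density (cayley_pullback (clark_disk (F \<circ> inv_into upper_half_plane cayley)))
       (\<lambda>t. ennreal (1 / (pi * (1 + t\<^sup>2))))"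

definition arctan_ext :: "ereal \<Rightarrow> real" where
  "arctan_ext x =
     (case x of ereal r \<Rightarrow> arctan r | PInfty \<Rightarrow> pi / 2 | MInfty \<Rightarrow> - (pi / 2))"

text \<open>
  For \<open>\<alpha> = 1\<close> either sign of infinity gives the same set \<open>clark_points a 1\<close> below, the two
  values of the arctangent differing by \<open>pi\<close>. Otherwise the complex number under \<open>Re\<close> is
  real, as \<open>clark_arg_real\<close> shows.
\<close>

definition clark_arg :: "real \<Rightarrow> complex \<Rightarrow> ereal" where
  "clark_arg a \<alpha> =
     (if \<alpha> = 1 then \<infinity>
      else ereal (Re ((cnj \<alpha> + 1) / (cnj \<alpha> - 1) * tan (\<i> * of_real a))))"

lemma clark_arg_real:
  fixes a :: real and \<alpha> :: complex
  assumes "cmod \<alpha> = 1"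
  shows "(cnj \<alpha> + 1) / (cnj \<alpha> - 1) * tan (\<i> * of_real a) \<in> \<real>"
proof -
  let ?z = "(cnj \<alpha> + 1) / (cnj \<alpha> - 1) * tan (\<i> * of_real a)"
  have t: "cnj (tan (\<i> * complex_of_real a)) = - tan (\<i> * complex_of_real a)"
    by (simp add: tan_def cnj_sin cnj_cos)
  have n: "\<alpha> * cnj \<alpha> = 1"
    using assms by (simp add: complex_norm_square [symmetric])
  have "cnj ?z = ?z"
  proof (cases "\<alpha> = 1")
    case False
    then have "cnj \<alpha> \<noteq> 1" by (metis complex_cnj_cnj complex_cnj_one)
    with False n have "(\<alpha> + 1) / (\<alpha> - 1) = - ((cnj \<alpha> + 1) / (cnj \<alpha> - 1))"
      by (simp add: divide_simps) (simp add: algebra_simps)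
    with t show ?thesis by (simp only: complex_cnj_mult complex_cnj_divide complex_cnj_add
        complex_cnj_diff complex_cnj_cnj complex_cnj_one minus_mult_minus)
  qed simp
  then show ?thesis by (simp add: Reals_cnj_iff)
qed

definition clark_points :: "real \<Rightarrow> complex \<Rightarrow> real set" where
  "clark_points a \<alpha> = {1 / a * arctan_ext (clark_arg a \<alpha>) + of_int n * pi / a | n :: int. True}"

end

theory Submission imports Defs "HOL-Complex_Analysis.Complex_Analysis" begin

text \<open>
  By uniqueness of the Clark measure it suffices to exhibit one, and it is purely atomic.
  Let \<open>\<theta>\<close> be the real number with \<open>\<alpha>* sin (\<theta> - ia) = sin (\<theta> + ia)\<close>, that is,
  \<open>tan \<theta> = (\<alpha>* + 1) / (\<alpha>* - 1) tan (ia)\<close>. Then the denominator of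
  \<open>(1 + B \<alpha>*) / (1 - B \<alpha>*)\<close> is a multiple of \<open>sin (aw - \<theta>)\<close>, and the real part of the quotient is
  \<open>- C Im cot (aw - \<theta>)\<close> with \<open>C > 0\<close>. The partial fraction expansion of the cotangent writes this
  as a Poisson integral with masses at the points \<open>(\<theta> - k\<pi>) / a\<close>.

  Uniqueness: the Poisson integral of a measure is, up to the total mass, the real part of a power
  series whose coefficients are its trigonometric moments, so it determines these moments, and they
  determine the measure by the Stone-Weierstrass theorem.
\<close>

section \<open>Measures determined by continuous test functions and by moments on the circle\<close>

text \<open>The indicator of a closed set is a bounded pointwise limit of continuous functions, so
  dominated convergence gives agreement on closed sets, which generate the Borel sets.\<close>

lemma finite_measure_eqI_continuous:
  fixes M N :: "'a::metric_space measure"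
  assumes "finite_measure M" "finite_measure N"
    and M: "sets M = sets (restrict_space borel S)" and N: "sets N = sets (restrict_space borel S)"
    and eq: "\<And>f::'a \<Rightarrow> real. continuous_on UNIV f \<Longrightarrow> (\<integral>x. f x \<partial>M) = (\<integral>x. f x \<partial>N)"
  shows "M = N"
proof -
  interpret M: finite_measure M by fact
  interpret N: finite_measure N by fact
  have sp: "space M = S" "space N = S"
    using sets_eq_imp_space_eq[OF M] sets_eq_imp_space_eq[OF N] by (simp_all add: space_restrict_space)
  have mM: "f \<in> measurable M borel" if "f \<in> borel_measurable borel" for f :: "'a \<Rightarrow> 'b::topological_space"
    using measurable_restrict_space1[OF that] measurable_cong_sets[OF M refl] by blast
  have mN: "f \<in> measurable N borel" if "f \<in> borel_measurable borel" for f :: "'a \<Rightarrow> 'b::topological_space"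
    using measurable_restrict_space1[OF that] measurable_cong_sets[OF N refl] by blast
  have id_M: "(\<lambda>x. x) \<in> measurable M borel" and id_N: "(\<lambda>x. x) \<in> measurable N borel"
    by (rule mM mN, simp)+
  have closed_eq: "emeasure M (C \<inter> S) = emeasure N (C \<inter> S)" if C: "closed C" for C
  proof (cases "C = {}")
    \<comment> \<open>The empty set is treated apart because \<open>infdist x {} = 0\<close>, which
      would make every \<open>f n\<close> constantly 1.\<close>
    case False
    \<comment> \<open>\<open>f n\<close> is 1 on \<open>C\<close> and vanishes at distance at least
      \<open>1 / n\<close> from it.\<close>
    define f where "f n x = max 0 (1 - real n * infdist x C)" for n x
    have cont: "continuous_on UNIV (f n)" for n
      unfolding f_def by (intro continuous_intros)
    have bound: "norm (f n x) \<le> 1" for n x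
      by (simp add: f_def infdist_nonneg)
    have lim: "(\<lambda>n. f n x) \<longlonglongrightarrow> indicator C x" for x
    proof (cases "x \<in> C")
      case True
      then show ?thesis by (simp add: f_def)
    next
      case outside: False
      then have pos: "infdist x C > 0"
        using C False by (simp add: infdist_pos_not_in_closed)
      then obtain k where k: "1 < real k * infdist x C"
        using reals_Archimedean3 by blast
      have "f n x = 0" if "n \<ge> k" for n
      proof -
        have "real k * infdist x C \<le> real n * infdist x C"
          using that pos by simp
        with k show ?thesis by (simp add: f_def)
      qed
      then have "eventually (\<lambda>n. f n x = 0) sequentially"
        using eventually_sequentially by blast
      then show ?thesis using outside by (simp add: tendsto_eventually)
    qed
    have ind: "indicator C \<in> borel_measurable (borel :: 'a measure)"
      using C by simp
    have limM: "(\<lambda>n. \<integral>x. f n x \<partial>M) \<longlonglongrightarrow> (\<integral>x. indicator C x \<partial>M)"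
      by (rule integral_dominated_convergence[where w = "\<lambda>_. 1"])
         (use bound lim in \<open>auto intro!: mM borel_measurable_continuous_onI cont ind\<close>)
    have limN: "(\<lambda>n. \<integral>x. f n x \<partial>N) \<longlonglongrightarrow> (\<integral>x. indicator C x \<partial>N)"
      by (rule integral_dominated_convergence[where w = "\<lambda>_. 1"])
         (use bound lim in \<open>auto intro!: mN borel_measurable_continuous_onI cont ind\<close>)
    have "(\<integral>x. indicator C x \<partial>M) = (\<integral>x. indicator C x \<partial>N :: real)"
      by (rule LIMSEQ_unique[OF limM[unfolded eq[OF cont]] limN])
    then have "measure M (C \<inter> S) = measure N (C \<inter> S)"
      by (simp add: sp)
    then show ?thesis
      by (simp add: M.emeasure_eq_measure N.emeasure_eq_measure)
  qed simp
  \<comment> \<open>Pushing both measures forward along the inclusion of \<open>S\<close> makes them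
    Borel measures on the whole space, where the closed sets are an intersection-stable
    generator.\<close>
  have "distr M borel (\<lambda>x. x) = distr N borel (\<lambda>x. x)"
  proof (rule measure_eqI_generator_eq[where E = "{C. closed C}" and \<Omega> = UNIV and A = "\<lambda>_. UNIV"])
    show "Int_stable {C::'a set. closed C}"
      by (auto simp: Int_stable_def)
    show "emeasure (distr M borel (\<lambda>x. x)) X = emeasure (distr N borel (\<lambda>x. x)) X"
      if "X \<in> {C. closed C}" for X
      using closed_eq[of X] that by (simp add: emeasure_distr id_M id_N sp)
    show "sets (distr M borel (\<lambda>x. x)) = sigma_sets UNIV {C. closed C}"
      by (simp add: borel_eq_closed)
    show "sets (distr N borel (\<lambda>x. x)) = sigma_sets UNIV {C. closed C}"
      by (simp add: borel_eq_closed)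
    show "emeasure (distr M borel (\<lambda>x. x)) UNIV \<noteq> \<infinity>"
      by (simp add: emeasure_distr id_M)
  qed auto
  then have "emeasure M (B \<inter> S) = emeasure N (B \<inter> S)" if "B \<in> sets borel" for B
    using that emeasure_distr[OF id_M that] emeasure_distr[OF id_N that] by (simp add: sp)
  then show ?thesis
    by (intro measure_eqI) (auto simp: M N sets_restrict_space Int_commute)
qed

text \<open>Only monomials and sums are constructors, so that equality of integrals passes from the
  moments to all members by induction; closure under products is derived separately.\<close>

inductive trig_polynomial :: "(complex \<Rightarrow> complex) \<Rightarrow> bool" where
  monomial: "trig_polynomial (\<lambda>z. c * z ^ i * cnj z ^ j)"
| add: "trig_polynomial f \<Longrightarrow> trig_polynomial g \<Longrightarrow> trig_polynomial (\<lambda>z. f z + g z)"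

lemma trig_polynomial_mult:
  assumes "trig_polynomial f" "trig_polynomial g"
  shows "trig_polynomial (\<lambda>z. f z * g z)"
  using assms(1)
proof induction
  case (monomial c i j)
  show ?case
    using assms(2)
  proof induction
    case (monomial d k l)
    have "trig_polynomial (\<lambda>z. (c * d) * z ^ (i + k) * cnj z ^ (j + l))"
      by (rule trig_polynomial.monomial)
    then show ?case by (simp add: power_add mult_ac)
  next
    case (add p q)
    then show ?case using trig_polynomial.add[OF add.IH] by (simp add: distrib_left)
  qed
next
  case (add p q)
  then show ?case using trig_polynomial.add[OF add.IH] by (simp add: distrib_right)
qed

lemma real_polynomial_function_imp_trig_polynomial:
  fixes p :: "complex \<Rightarrow> real"
  assumes "real_polynomial_function p"
  shows "trig_polynomial (\<lambda>z. of_real (p z))"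
  using assms
proof induction
  case (linear f)
  interpret bounded_linear f by fact
  \<comment> \<open>The coefficients come from \<open>Re z = (z + cnj z) / 2\<close> and
    \<open>Im z = (z - cnj z) / (2 * \<i>)\<close>, inserted into
    \<open>f z = Re z * f 1 + Im z * f \<i>\<close>.\<close>
  let ?a = "complex_of_real (f 1) / 2" and ?b = "complex_of_real (f \<i>) / (2 * \<i>)"
  have eq: "complex_of_real (f z) = (?a + ?b) * z ^ 1 * cnj z ^ 0 + (?a - ?b) * z ^ 0 * cnj z ^ 1" for z
  proof -
    have "f z = f (Re z *\<^sub>R 1 + Im z *\<^sub>R \<i>)"
      by (rule arg_cong[where f = f]) (simp add: complex_eq_iff)
    then have "f z = Re z * f 1 + Im z * f \<i>"
      by (simp add: add scaleR)
    then show ?thesis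
      by (simp add: complex_eq_iff)
  qed
  show ?case
    by (rule ssubst[OF ext[OF eq], of trig_polynomial]) (intro trig_polynomial.intros)
next
  case (const c)
  show ?case using trig_polynomial.monomial[of "of_real c" 0 0] by simp
next
  case (add f g)
  show ?case using trig_polynomial.add[OF add.IH] by simp
next
  case (mult f g)
  show ?case using trig_polynomial_mult[OF mult.IH] by simp
qed

text \<open>On the circle \<open>z * cnj z = 1\<close> reduces each monomial in \<open>z\<close> and
  \<open>cnj z\<close> to a power of \<open>cnj z\<close> or the conjugate of one, so one-sided
  moments fix the integrals of all trigonometric polynomials. By Stone-Weierstrass these approximate
  continuous functions uniformly.\<close>

lemma circle_measure_eqI:
  fixes M N :: "complex measure"
  assumes "finite_measure M" "finite_measure N"
    and M: "sets M = sets (restrict_space borel (sphere 0 1))"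
    and N: "sets N = sets (restrict_space borel (sphere 0 1))"
    and moments: "\<And>n. (\<integral>z. cnj z ^ n \<partial>M) = (\<integral>z. cnj z ^ n \<partial>N)"
  shows "M = N"
proof (rule finite_measure_eqI_continuous[OF assms(1,2) M N])
  interpret M: finite_measure M by fact
  interpret N: finite_measure N by fact
  have sp: "space M = sphere 0 1" "space N = sphere 0 1"
    using sets_eq_imp_space_eq[OF M] sets_eq_imp_space_eq[OF N] by (simp_all add: space_restrict_space)
  have mM: "f \<in> measurable M borel" if "continuous_on UNIV f" for f :: "complex \<Rightarrow> 'b::topological_space"
    using measurable_restrict_space1[OF borel_measurable_continuous_onI[OF that]]
      measurable_cong_sets[OF M refl] by blast
  have mN: "f \<in> measurable N borel" if "continuous_on UNIV f" for f :: "complex \<Rightarrow> 'b::topological_space"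
    using measurable_restrict_space1[OF borel_measurable_continuous_onI[OF that]]
      measurable_cong_sets[OF N refl] by blast
  have bdd: "\<exists>B. \<forall>z\<in>sphere 0 1. norm (f z) \<le> B" if "continuous_on UNIV f"
    for f :: "complex \<Rightarrow> 'b::real_normed_vector"
    using compact_imp_bounded[OF compact_continuous_image[OF continuous_on_subset[OF that subset_UNIV]
          compact_sphere, of 0 1]] by (auto simp: bounded_iff)
  have iM: "integrable M f" if "continuous_on UNIV f" for f :: "complex \<Rightarrow> 'b::{banach,second_countable_topology}"
  proof -
    obtain B where "\<forall>z\<in>sphere 0 1. norm (f z) \<le> B"
      using bdd[OF \<open>continuous_on UNIV f\<close>] by blast
    with mM[OF \<open>continuous_on UNIV f\<close>] show ?thesis
      by (intro M.integrable_const_bound[of _ B]) (auto simp: sp)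
  qed
  have iN: "integrable N f" if "continuous_on UNIV f" for f :: "complex \<Rightarrow> 'b::{banach,second_countable_topology}"
  proof -
    obtain B where "\<forall>z\<in>sphere 0 1. norm (f z) \<le> B"
      using bdd[OF \<open>continuous_on UNIV f\<close>] by blast
    with mN[OF \<open>continuous_on UNIV f\<close>] show ?thesis
      by (intro N.integrable_const_bound[of _ B]) (auto simp: sp)
  qed
  have mom: "(\<integral>z. z ^ i * cnj z ^ j \<partial>M) = (\<integral>z. z ^ i * cnj z ^ j \<partial>N)" for i j
  proof -
    have 1: "z ^ i * cnj z ^ j = (if i \<le> j then cnj z ^ (j - i) else cnj (cnj z ^ (i - j)))"
      if "z \<in> sphere 0 1" for z
    proof -
      have n: "z * cnj z = 1"
        using that by (simp add: complex_norm_square[symmetric])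
      have "z ^ i * cnj z ^ j = (z * cnj z) ^ i * cnj z ^ (j - i)" if "i \<le> j"
        using power_add[of "cnj z" i "j - i"] that by (simp add: power_mult_distrib)
      moreover have "z ^ i * cnj z ^ j = (z * cnj z) ^ j * z ^ (i - j)" if "\<not> i \<le> j"
        using power_add[of z j "i - j"] that by (simp add: power_mult_distrib)
      ultimately show ?thesis using n by auto
    qed
    have "(\<integral>z. z ^ i * cnj z ^ j \<partial>M) = (\<integral>z. (if i \<le> j then cnj z ^ (j - i) else cnj (cnj z ^ (i - j))) \<partial>M)"
      by (intro Bochner_Integration.integral_cong) (use 1 in \<open>auto simp: sp\<close>)
    also have "\<dots> = (\<integral>z. (if i \<le> j then cnj z ^ (j - i) else cnj (cnj z ^ (i - j))) \<partial>N)"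
      by (cases "i \<le> j") (simp_all only: if_True if_False moments Bochner_Integration.integral_cnj simp_thms)
    also have "\<dots> = (\<integral>z. z ^ i * cnj z ^ j \<partial>N)"
      by (intro Bochner_Integration.integral_cong) (use 1 in \<open>auto simp: sp\<close>)
    finally show ?thesis .
  qed
  have trig: "continuous_on UNIV p \<and> (\<integral>z. p z \<partial>M) = (\<integral>z. p z \<partial>N)" if "trig_polynomial p" for p
    using that
  proof induction
    case (monomial c i j)
    show ?case using mom[of i j] by (auto simp: mult.assoc intro!: continuous_intros)
  next
    case (add f g)
    then show ?case by (auto simp: iM iN intro!: continuous_intros)
  qed
  fix f :: "complex \<Rightarrow> real"
  assume f: "continuous_on UNIV f"
  \<comment> \<open>Replacing \<open>f\<close> by a polynomial within \<open>e\<close> of it costs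
    \<open>e\<close> times the mass under each measure, hence \<open>e * K\<close> in total.\<close>
  define K where "K = measure M (space M) + measure N (space N)"
  have K: "K \<ge> 0" by (simp add: K_def)
  have small: "\<bar>(\<integral>z. f z \<partial>M) - (\<integral>z. f z \<partial>N)\<bar> \<le> e * K" if "e > 0" for e
  proof -
    obtain g where g: "real_polynomial_function g" "\<And>x. x \<in> sphere 0 1 \<Longrightarrow> \<bar>f x - g x\<bar> < e"
      using Stone_Weierstrass_real_polynomial_function[OF compact_sphere
          continuous_on_subset[OF f subset_UNIV] \<open>e > 0\<close>] by metis
    have tg: "trig_polynomial (\<lambda>z. of_real (g z))"
      by (rule real_polynomial_function_imp_trig_polynomial[OF g(1)])
    have cg: "continuous_on UNIV g"
      using continuous_on_Re[OF conjunct1[OF trig[OF tg]]] by simp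
    have "complex_of_real (\<integral>z. g z \<partial>M) = of_real (\<integral>z. g z \<partial>N)"
      using conjunct2[OF trig[OF tg]] by (simp only: integral_complex_of_real)
    then have gg: "(\<integral>z. g z \<partial>M) = (\<integral>z. g z \<partial>N)" by simp
    have "\<bar>(\<integral>z. f z \<partial>M) - (\<integral>z. g z \<partial>M)\<bar> \<le> e * measure M (space M)"
    proof -
      have "\<bar>(\<integral>z. f z \<partial>M) - (\<integral>z. g z \<partial>M)\<bar> = \<bar>\<integral>z. f z - g z \<partial>M\<bar>"
        by (simp add: iM f cg)
      also have "\<dots> \<le> (\<integral>z. \<bar>f z - g z\<bar> \<partial>M)"
        by (rule integral_abs_bound)
      also have "\<dots> \<le> (\<integral>z. e \<partial>M)"
        by (intro integral_mono iM continuous_intros f cg) (use g(2) in \<open>auto simp: sp less_imp_le\<close>)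
      finally show ?thesis by (simp add: mult.commute)
    qed
    moreover have "\<bar>(\<integral>z. f z \<partial>N) - (\<integral>z. g z \<partial>N)\<bar> \<le> e * measure N (space N)"
    proof -
      have "\<bar>(\<integral>z. f z \<partial>N) - (\<integral>z. g z \<partial>N)\<bar> = \<bar>\<integral>z. f z - g z \<partial>N\<bar>"
        by (simp add: iN f cg)
      also have "\<dots> \<le> (\<integral>z. \<bar>f z - g z\<bar> \<partial>N)"
        by (rule integral_abs_bound)
      also have "\<dots> \<le> (\<integral>z. e \<partial>N)"
        by (intro integral_mono iN continuous_intros f cg) (use g(2) in \<open>auto simp: sp less_imp_le\<close>)
      finally show ?thesis by (simp add: mult.commute)
    qed
    ultimately show ?thesis using gg by (simp add: K_def distrib_left)
  qed
  have "\<bar>(\<integral>z. f z \<partial>M) - (\<integral>z. f z \<partial>N)\<bar> \<le> 0 + d" if "d > 0" for d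
  proof -
    \<comment> \<open>The \<open>+ 1\<close> avoids division by zero when both measures
      vanish.\<close>
    have "d / (K + 1) * K \<le> d"
      using K that by (simp add: divide_simps)
    with small[of "d / (K + 1)"] K that show ?thesis
      by (smt (verit) divide_pos_pos)
  qed
  then have "\<bar>(\<integral>z. f z \<partial>M) - (\<integral>z. f z \<partial>N)\<bar> \<le> 0"
    by (rule field_le_epsilon)
  then show "(\<integral>z. f z \<partial>M) = (\<integral>z. f z \<partial>N)" by simp
qed

section \<open>Uniqueness of the Clark measure on the circle\<close>

text \<open>A subset of the imaginary axis contains no nonempty open set, so the open mapping
  theorem makes \<open>g\<close> constant. Index 0 is left out since an imaginary constant may
  remain there.\<close>

lemma Re_powser_0_imp_coeff_0:
  fixes d :: "nat \<Rightarrow> complex"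
  assumes sm: "\<And>w. w \<in> ball 0 1 \<Longrightarrow> (\<lambda>n. d n * w ^ n) sums g w"
    and Re0: "\<And>w. w \<in> ball 0 1 \<Longrightarrow> Re (g w) = 0"
    and "n > 0"
  shows "d n = 0"
proof (rule ccontr)
  assume "d n \<noteq> 0"
  have hol: "g holomorphic_on ball 0 1"
    by (rule power_series_holomorphic[where a = d]) (use sm in auto)
  have "g constant_on ball 0 1"
  proof (rule ccontr)
    assume "\<not> g constant_on ball 0 1"
    then have "open (g ` ball 0 1)"
      by (intro open_mapping_thm[OF hol]) auto
    moreover have "g 0 \<in> g ` ball 0 1" by simp
    ultimately obtain e where "e > 0" and e: "ball (g 0) e \<subseteq> g ` ball 0 1"
      using open_contains_ball by blast
    have "g 0 + of_real (e / 2) \<in> ball (g 0) e"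
      using \<open>e > 0\<close> by (simp add: dist_norm)
    then obtain w where "w \<in> ball 0 1" "g w = g 0 + of_real (e / 2)"
      using e by auto
    then show False
      using Re0[of w] Re0[of 0] \<open>e > 0\<close> by simp
  qed
  then obtain c where c: "\<And>w. w \<in> ball 0 1 \<Longrightarrow> g w = c"
    by (auto simp: constant_on_def)
  have d0: "d 0 = c"
    using sm[of 0] c[of 0] by simp
  \<comment> \<open>With the constant term removed, the series sums to 0 on the disk; a nonzero
    coefficient would isolate its zero at the origin.\<close>
  let ?a = "\<lambda>n. if n = 0 then 0 else d n"
  have sm0: "(\<lambda>n. ?a n * (w - 0) ^ n) sums 0" if "norm (w - 0) < 1" for w
  proof -
    have "(\<lambda>n. d n * w ^ n - (if n = 0 then c else 0)) sums (g w - c)"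
      by (intro sums_diff sm sums_If_finite_set[of "{0}" "\<lambda>_. c", simplified]) (use that in simp)
    moreover have "(\<lambda>n. d n * w ^ n - (if n = 0 then c else 0)) = (\<lambda>n. ?a n * (w - 0) ^ n)"
      by (auto simp: d0)
    ultimately show ?thesis using c[of w] that by simp
  qed
  show False
  proof (rule powser_0_nonzero[of 1 0 ?a "\<lambda>_. 0" n, OF _ sm0])
    show "?a n \<noteq> 0"
      using \<open>d n \<noteq> 0\<close> \<open>n > 0\<close> by simp
    fix s :: real
    assume "s > 0" and s: "\<And>z::complex. z \<in> cball 0 s - {0} \<Longrightarrow> (0::complex) \<noteq> 0"
    have "complex_of_real s \<in> cball 0 s - {0}"
      using \<open>s > 0\<close> by simp
    from s[OF this] show False by simp
  qed (use \<open>n > 0\<close> in auto)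
qed

text \<open>Multiplication by \<open>cnj z\<close>, of modulus 1, moves the boundary point to 1. The
  right-hand side is chosen for its geometric series in \<open>cnj z * \<zeta>\<close>, whose
  integrated terms are moments.\<close>

lemma poisson_kernel_eq_Re:
  assumes "cmod z = 1" "cmod \<zeta> < 1"
  shows "(1 - (cmod \<zeta>)\<^sup>2) / (cmod (z - \<zeta>))\<^sup>2 = 2 * Re (1 / (1 - cnj z * \<zeta>)) - 1"
proof -
  define w where "w = cnj z * \<zeta>"
  have "1 - w = cnj z * (z - \<zeta>)"
    using assms(1) by (simp add: w_def algebra_simps complex_norm_square[symmetric])
  then have n1: "cmod (z - \<zeta>) = cmod (1 - w)"
    using assms(1) by (simp add: norm_mult)
  have n2: "cmod \<zeta> = cmod w"
    using assms(1) by (simp add: w_def norm_mult)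
  have "w \<noteq> 1"
    using assms(2) n2 by auto
  then have pos: "(cmod (1 - w))\<^sup>2 \<noteq> 0"
    by simp
  have "Re (1 / (1 - w)) = (1 - Re w) / (cmod (1 - w))\<^sup>2"
    by (simp add: Re_divide cmod_def)
  moreover have "2 * (1 - Re w) - (cmod (1 - w))\<^sup>2 = 1 - (cmod w)\<^sup>2"
    unfolding cmod_power2 by (simp add: power2_eq_square algebra_simps)
  ultimately show ?thesis
    unfolding n1 n2 w_def[symmetric] using pos by (simp add: field_simps)
qed

text \<open>At \<open>\<zeta> = 0\<close> the Poisson kernel is 1 on the whole circle, so its
  integrability is finiteness of the mass.\<close>

lemma finite_measure_is_clark_disk:
  assumes "is_clark_disk f M"
  shows "finite_measure M"
proof -
  have sp: "space M = sphere 0 1"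
    using assms sets_eq_imp_space_eq[of M] by (auto simp: is_clark_disk_def space_restrict_space)
  have "integrable M (\<lambda>z. (1 - (cmod 0)\<^sup>2) / (cmod (z - 0))\<^sup>2)"
    using assms centre_in_ball[of "0::complex" 1]
    unfolding is_clark_disk_def has_bochner_integral_iff by fastforce
  moreover have "integrable M (\<lambda>z. (1 - (cmod 0)\<^sup>2) / (cmod (z - 0))\<^sup>2) = integrable M (\<lambda>z. 1 :: real)"
    by (rule Bochner_Integration.integrable_cong) (auto simp: sp)
  ultimately have "integrable M (\<lambda>z. 1 :: real)"
    by blast
  then show ?thesis
    by (intro finite_measureI) (auto simp: integrable_iff_bounded less_top)
qed

text \<open>The geometric series of the kernel is integrated term by term, which
  \<open>cmod \<zeta> < 1\<close> permits; the summand \<open>- 1\<close> of the kernel yields the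
  total mass.\<close>

lemma is_clark_disk_sums:
  assumes clark: "is_clark_disk f M" and \<zeta>: "\<zeta> \<in> ball 0 1"
  obtains S where "(\<lambda>n. (\<integral>z. cnj z ^ n \<partial>M) * \<zeta> ^ n) sums S"
    "2 * Re S - measure M (space M) = Re ((1 + f \<zeta>) / (1 - f \<zeta>))"
proof -
  interpret finite_measure M
    by (rule finite_measure_is_clark_disk[OF clark])
  have sets: "sets M = sets (restrict_space borel (sphere 0 1))"
    using clark by (simp add: is_clark_disk_def)
  have sp: "space M = sphere 0 1"
    using sets_eq_imp_space_eq[OF sets] by (simp add: space_restrict_space)
  have meas: "(\<lambda>z. cnj z ^ n * \<zeta> ^ n) \<in> borel_measurable M" for n
  proof -
    have "(\<lambda>z. cnj z ^ n * \<zeta> ^ n) \<in> borel_measurable borel"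
      by (intro borel_measurable_continuous_onI continuous_intros)
    from measurable_restrict_space1[OF this] show ?thesis
      by (simp add: measurable_cong_sets[OF sets refl])
  qed
  have nz: "norm (cnj z ^ n * \<zeta> ^ n) = cmod \<zeta> ^ n" if "z \<in> space M" for z n
    using that by (simp add: sp norm_mult norm_power)
  have int: "integrable M (\<lambda>z. cnj z ^ n * \<zeta> ^ n)" for n
    by (rule integrable_const_bound[of _ "cmod \<zeta> ^ n"]) (use nz meas in auto)
  have "(\<integral>z. norm (cnj z ^ n * \<zeta> ^ n) \<partial>M) = cmod \<zeta> ^ n * measure M (space M)" for n
  proof -
    have "(\<integral>z. norm (cnj z ^ n * \<zeta> ^ n) \<partial>M) = (\<integral>z. cmod \<zeta> ^ n \<partial>M)"
      by (intro Bochner_Integration.integral_cong refl nz)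
    then show ?thesis by (simp add: mult.commute)
  qed
  moreover have sg: "summable (\<lambda>n. cmod \<zeta> ^ n)"
    using \<zeta> by (intro summable_geometric) simp
  ultimately have sm: "summable (\<lambda>n. \<integral>z. norm (cnj z ^ n * \<zeta> ^ n) \<partial>M)"
    by (simp only: summable_mult2)
  have ae: "AE z in M. summable (\<lambda>n. norm (cnj z ^ n * \<zeta> ^ n))"
    using sg by (auto simp: nz)
  let ?g = "\<lambda>z. \<Sum>n. cnj z ^ n * \<zeta> ^ n"
  have g: "?g z = 1 / (1 - cnj z * \<zeta>)" if "z \<in> space M" for z
    using suminf_geometric[of "cnj z * \<zeta>"] that \<zeta> by (simp add: sp norm_mult power_mult_distrib)
  have ig: "integrable M ?g"
    by (rule integrable_suminf[OF int ae sm])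
  have 1: "(\<lambda>n. \<integral>z. cnj z ^ n * \<zeta> ^ n \<partial>M) sums (\<integral>z. ?g z \<partial>M)"
    by (rule sums_integral[OF int ae sm])
  have "Re ((1 + f \<zeta>) / (1 - f \<zeta>)) = (\<integral>z. (1 - (cmod \<zeta>)\<^sup>2) / (cmod (z - \<zeta>))\<^sup>2 \<partial>M)"
    using clark \<zeta> by (auto simp: is_clark_disk_def has_bochner_integral_iff)
  also have "\<dots> = (\<integral>z. 2 * Re (?g z) - 1 \<partial>M)"
    by (intro Bochner_Integration.integral_cong refl, subst poisson_kernel_eq_Re)
       (use \<zeta> in \<open>auto simp: g sp\<close>)
  also have "\<dots> = 2 * Re (\<integral>z. ?g z \<partial>M) - measure M (space M)"
    using ig by simp
  finally have 2: "2 * Re (\<integral>z. ?g z \<partial>M) - measure M (space M) = Re ((1 + f \<zeta>) / (1 - f \<zeta>))"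
    by simp
  show ?thesis
    by (rule that[OF _ 2]) (use 1 in simp)
qed

text \<open>Once the total masses agree, the difference of the two moment series has zero real part
  on the disk, so all its higher coefficients vanish.\<close>

lemma is_clark_disk_unique:
  assumes M: "is_clark_disk f M" and N: "is_clark_disk f N"
  shows "M = N"
proof -
  interpret M: finite_measure M by (rule finite_measure_is_clark_disk[OF M])
  interpret N: finite_measure N by (rule finite_measure_is_clark_disk[OF N])
  let ?a = "\<lambda>n. (\<integral>z. cnj z ^ n \<partial>M)" and ?b = "\<lambda>n. (\<integral>z. cnj z ^ n \<partial>N)"
  have a0: "?a 0 = measure M (space M)" and b0: "?b 0 = measure N (space N)"
    by (simp_all add: scaleR_conv_of_real)
  \<comment> \<open>At the origin the series reduces to the zeroth moment, so the identity reads
    twice the mass minus the mass.\<close>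
  have "measure M (space M) = Re ((1 + f 0) / (1 - f 0))"
  proof -
    obtain S where S: "(\<lambda>n. ?a n * 0 ^ n) sums S" "2 * Re S - measure M (space M) = Re ((1 + f 0) / (1 - f 0))"
      using is_clark_disk_sums[OF M, of 0] by auto
    have "S = measure M (space M)"
      using S(1) a0 by simp
    with S(2) show ?thesis by simp
  qed
  moreover have "measure N (space N) = Re ((1 + f 0) / (1 - f 0))"
  proof -
    obtain S where S: "(\<lambda>n. ?b n * 0 ^ n) sums S" "2 * Re S - measure N (space N) = Re ((1 + f 0) / (1 - f 0))"
      using is_clark_disk_sums[OF N, of 0] by auto
    have "S = measure N (space N)"
      using S(1) b0 by simp
    with S(2) show ?thesis by simp
  qed
  ultimately have total: "measure M (space M) = measure N (space N)"
    by simp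
  have "\<exists>S. (\<lambda>n. (?a n - ?b n) * w ^ n) sums S \<and> Re S = 0" if w: "w \<in> ball 0 1" for w
  proof -
    obtain S where S: "(\<lambda>n. ?a n * w ^ n) sums S" "2 * Re S - measure M (space M) = Re ((1 + f w) / (1 - f w))"
      using is_clark_disk_sums[OF M w] .
    obtain T where T: "(\<lambda>n. ?b n * w ^ n) sums T" "2 * Re T - measure N (space N) = Re ((1 + f w) / (1 - f w))"
      using is_clark_disk_sums[OF N w] .
    have "(\<lambda>n. (?a n - ?b n) * w ^ n) sums (S - T)"
      using sums_diff[OF S(1) T(1)] by (simp add: left_diff_distrib)
    moreover have "Re (S - T) = 0"
      using S(2) T(2) total by simp
    ultimately show ?thesis by blast
  qed
  then obtain g where g: "\<And>w. w \<in> ball 0 1 \<Longrightarrow> (\<lambda>n. (?a n - ?b n) * w ^ n) sums g w"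
    "\<And>w. w \<in> ball 0 1 \<Longrightarrow> Re (g w) = 0"
    by metis
  have "?a n = ?b n" for n
  proof (cases "n = 0")
    case True
    then show ?thesis using total by simp
  next
    case False
    then show ?thesis using Re_powser_0_imp_coeff_0[OF g] by simp
  qed
  then show ?thesis
    using M N by (intro circle_measure_eqI M.finite_measure_axioms N.finite_measure_axioms)
      (auto simp: is_clark_disk_def)
qed

section \<open>Partial fractions of the cotangent\<close>

text \<open>The logarithmic derivative of the reflection formula of the Gamma function.\<close>

lemma Digamma_reflection_complex:
  fixes z :: complex
  assumes "z \<notin> \<int>"
  shows "Digamma (1 - z) - Digamma z = of_real pi * cot (of_real pi * z)"
proof -
  have z: "z \<notin> \<int>\<^sub>\<le>\<^sub>0" and z': "1 - z \<notin> \<int>\<^sub>\<le>\<^sub>0"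
    using assms nonpos_Ints_Int[of z] nonpos_Ints_Int[of "1 - z"] by (auto simp: minus_in_Ints_iff)
  have s: "sin (of_real pi * z) \<noteq> 0"
    using assms by (auto simp: sin_eq_0)
  let ?G = "\<lambda>z::complex. Gamma z * Gamma (1 - z)"
  have der: "(?G has_field_derivative ?G z * (Digamma z - Digamma (1 - z))) (at z)"
    using z z' by (auto intro!: derivative_eq_intros simp: algebra_simps)
  have G: "?G = (\<lambda>z. of_real pi / sin (of_real pi * z))"
    using Gamma_reflection_complex by blast
  have "((\<lambda>z. of_real pi / sin (of_real pi * z)) has_field_derivative
      - (of_real pi * (cos (of_real pi * z) * of_real pi)) / (sin (of_real pi * z) * sin (of_real pi * z))) (at z)"
    using s by (auto intro!: derivative_eq_intros)
  from DERIV_unique[OF der this[folded G]]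
  have "of_real pi / sin (of_real pi * z) * (Digamma z - Digamma (1 - z)) =
      - (of_real pi * (cos (of_real pi * z) * of_real pi)) / (sin (of_real pi * z) * sin (of_real pi * z))"
    by (simp only: Gamma_reflection_complex)
  then have "Digamma z - Digamma (1 - z) = - (of_real pi * cos (of_real pi * z)) / sin (of_real pi * z)"
    using mult_left_cancel[of "of_real pi / sin (of_real pi * z)" "Digamma z - Digamma (1 - z)"
        "- (of_real pi * cos (of_real pi * z)) / sin (of_real pi * z)"] s
    by (simp add: mult_ac)
  then show ?thesis
    by (simp add: cot_def algebra_simps)
qed

text \<open>The limit formulas for \<open>Digamma\<close> at \<open>1 - z\<close> and
  \<open>z\<close> are subtracted, and the logarithms cancel. The terms \<open>n < m\<close> at
  \<open>1 - z\<close> give the indices \<open>-(n + 1)\<close> and those at \<open>z\<close> the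
  indices \<open>n\<close>, whence the half-open window.\<close>

lemma cot_partial_fractions:
  fixes z :: complex
  assumes "z \<notin> \<int>"
  shows "(\<lambda>m. \<Sum>k\<in>{- int m..<int m}. 1 / (z + of_int k)) \<longlonglongrightarrow> of_real pi * cot (of_real pi * z)"
proof -
  have z: "z \<noteq> 0" and z': "1 - z \<noteq> 0"
    using assms by auto
  have "(\<lambda>m. (of_real (ln (real m)) - (\<Sum>n<m. inverse (1 - z + of_nat n))) -
        (of_real (ln (real m)) - (\<Sum>n<m. inverse (z + of_nat n)))) \<longlonglongrightarrow> Digamma (1 - z) - Digamma z"
    by (intro tendsto_diff Digamma_LIMSEQ z z')
  moreover have "(of_real (ln (real m)) - (\<Sum>n<m. inverse (1 - z + of_nat n))) -
        (of_real (ln (real m)) - (\<Sum>n<m. inverse (z + of_nat n))) =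
        (\<Sum>k\<in>{- int m..<int m}. 1 / (z + of_int k))" for m
  proof (induction m)
    case (Suc m)
    have "{- int (Suc m)..<int (Suc m)} = insert (- int (Suc m)) (insert (int m) {- int m..<int m})"
      by auto
    moreover have "inverse (1 - z + of_nat m) = - (1 / (z + of_int (- int (Suc m))))"
      by (simp add: divide_inverse inverse_minus_eq[symmetric] del: inverse_minus_eq)
    ultimately show ?case using Suc.IH
      by (simp add: algebra_simps divide_inverse)
  qed simp
  ultimately show ?thesis
    using Digamma_reflection_complex[OF assms] by simp
qed

text \<open>Integer shifts do not change the imaginary part, so after a change of sign every term is
  positive; the limit can then be read as an unordered sum over the integers.\<close>

lemma Im_cot_partial_fractions:
  assumes "Im z > 0"
  shows "(\<lambda>m. \<Sum>k\<in>{- int m..<int m}. Im z / (cmod (z + of_int k))\<^sup>2) \<longlonglongrightarrow> - pi * Im (cot (of_real pi * z))"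
proof -
  have "z \<notin> \<int>"
    using assms by (auto elim: Ints_cases)
  from tendsto_minus[OF tendsto_Im[OF cot_partial_fractions[OF this]]]
  have "(\<lambda>m. - (\<Sum>k\<in>{- int m..<int m}. Im (1 / (z + of_int k)))) \<longlonglongrightarrow> - pi * Im (cot (of_real pi * z))"
    by simp
  moreover have "- (\<Sum>k\<in>{- int m..<int m}. Im (1 / (z + of_int k))) =
      (\<Sum>k\<in>{- int m..<int m}. Im z / (cmod (z + of_int k))\<^sup>2)" for m
    unfolding sum_negf[symmetric] by (intro sum.cong refl) (simp add: Im_divide cmod_power2)
  ultimately show ?thesis by simp
qed

section \<open>The Cayley transform and Poisson kernels\<close>

lemma cmod_cayley_of_real: "cmod (cayley (of_real t)) = 1"
proof -
  have "cmod (of_real t - \<i>) = cmod (of_real t + \<i>)"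
    by (simp add: cmod_def)
  moreover have "of_real t + \<i> \<noteq> 0"
    by (simp add: complex_eq_iff)
  ultimately show ?thesis
    by (simp add: cayley_def norm_divide)
qed

lemma cayley_of_real_neq_1: "cayley (of_real t) \<noteq> 1"
proof -
  have "of_real t + \<i> \<noteq> 0" "of_real t - \<i> \<noteq> of_real t + \<i>"
    by (simp_all add: complex_eq_iff)
  then show ?thesis
    by (simp add: cayley_def)
qed

lemma inverse_cayley:
  assumes "w \<noteq> - \<i>"
  shows "\<i> * (1 + cayley w) / (1 - cayley w) = w"
proof -
  have "w + \<i> \<noteq> 0"
    using assms by (simp add: eq_neg_iff_add_eq_0)
  then have "1 + cayley w = 2 * w / (w + \<i>)" "1 - cayley w = 2 * \<i> / (w + \<i>)"
    by (simp_all add: cayley_def field_simps)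
  with \<open>w + \<i> \<noteq> 0\<close> show ?thesis
    by simp
qed

lemma cayley_inverse:
  assumes "z \<noteq> 1"
  shows "cayley (\<i> * (1 + z) / (1 - z)) = z"
proof -
  have "\<i> * (1 + z) / (1 - z) + \<i> = 2 * \<i> / (1 - z)" "\<i> * (1 + z) / (1 - z) - \<i> = 2 * \<i> * z / (1 - z)"
    using assms by (simp_all add: divide_simps) (simp_all add: algebra_simps)
  then show ?thesis
    using assms by (simp add: cayley_def)
qed

lemma cayley_of_real_eq_iff: "cayley (of_real s) = cayley (of_real t) \<longleftrightarrow> s = t"
proof -
  have "complex_of_real u \<noteq> - \<i>" for u
    by (simp add: complex_eq_iff)
  then show ?thesis
    by (metis inverse_cayley of_real_eq_iff)
qed

text \<open>For \<open>z\<close> on the circle \<open>cnj z\<close> is the inverse of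
  \<open>z\<close>, so the inverse Cayley transform is fixed by conjugation and taking
  \<open>Re\<close> loses nothing.\<close>

lemma cayley_of_real_Re_inverse:
  assumes "cmod z = 1" "z \<noteq> 1"
  shows "cayley (of_real (Re (\<i> * (1 + z) / (1 - z)))) = z"
proof -
  have "z * cnj z = 1"
    using assms(1) by (simp add: complex_norm_square[symmetric])
  moreover have "cnj z \<noteq> 1"
    using assms(2) by (metis complex_cnj_cnj complex_cnj_one)
  ultimately have "cnj (\<i> * (1 + z) / (1 - z)) = \<i> * (1 + z) / (1 - z)"
    using assms(2) by (simp add: divide_simps) (simp add: algebra_simps)
  then have "of_real (Re (\<i> * (1 + z) / (1 - z))) = \<i> * (1 + z) / (1 - z)"
    by (metis Reals_cnj_iff of_real_Re)
  then show ?thesis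
    using cayley_inverse[OF assms(2)] by simp
qed

text \<open>The imaginary part of the explicit preimage is the Poisson kernel of the disk at the
  boundary point 1, hence positive. So \<zeta> lies in the image of the half-plane, as
  \<open>inv_into\<close> requires.\<close>

lemma cayley_inv_into:
  assumes "\<zeta> \<in> ball 0 1"
  shows "Im (inv_into upper_half_plane cayley \<zeta>) > 0" "cayley (inv_into upper_half_plane cayley \<zeta>) = \<zeta>"
proof -
  have "\<zeta> \<noteq> 1" using assms by auto
  have "\<i> * (1 + \<zeta>) / (1 - \<zeta>) = \<i> * ((1 + \<zeta>) * cnj (1 - \<zeta>)) / of_real ((cmod (1 - \<zeta>))\<^sup>2)"
    using complex_div_cnj[of "\<i> * (1 + \<zeta>)" "1 - \<zeta>"] by (simp add: mult.assoc)
  then have "Im (\<i> * (1 + \<zeta>) / (1 - \<zeta>)) = Re ((1 + \<zeta>) * cnj (1 - \<zeta>)) / (cmod (1 - \<zeta>))\<^sup>2"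
    by (simp only: Im_divide_of_real) simp
  moreover have "Re ((1 + \<zeta>) * cnj (1 - \<zeta>)) = 1 - (cmod \<zeta>)\<^sup>2"
    unfolding cmod_power2 by (simp add: power2_eq_square algebra_simps)
  moreover have "(cmod \<zeta>)\<^sup>2 < 1"
    using assms by (simp add: power_less_one_iff)
  ultimately have "Im (\<i> * (1 + \<zeta>) / (1 - \<zeta>)) > 0"
    using \<open>\<zeta> \<noteq> 1\<close> by simp
  then have "\<zeta> \<in> cayley ` upper_half_plane"
    using cayley_inverse[OF \<open>\<zeta> \<noteq> 1\<close>] by (metis image_eqI mem_Collect_eq)
  then show "Im (inv_into upper_half_plane cayley \<zeta>) > 0" "cayley (inv_into upper_half_plane cayley \<zeta>) = \<zeta>"
    using inv_into_into[of \<zeta> cayley upper_half_plane] f_inv_into_f[of \<zeta> cayley upper_half_plane] by auto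
qed

text \<open>
  The factor \<open>1 + s\<^sup>2\<close> explains the weights of \<open>atomic_circle_measure\<close> below: they turn Poisson kernels of
  the disk into those of the half-plane.
\<close>

lemma poisson_kernel_cayley:
  assumes "Im w > 0"
  shows "(1 - (cmod (cayley w))\<^sup>2) / (cmod (cayley (of_real s) - cayley w))\<^sup>2 =
    (1 + s\<^sup>2) * (Im w / (cmod (of_real s - w))\<^sup>2)"
proof -
  have nz: "w + \<i> \<noteq> 0" "complex_of_real s + \<i> \<noteq> 0" "of_real s - w \<noteq> 0"
    using assms by (auto simp: complex_eq_iff)
  define K where "K = (cmod (w + \<i>))\<^sup>2"
  have "K > 0" using nz by (simp add: K_def)
  have "1 - (cmod (cayley w))\<^sup>2 = (K - (cmod (w - \<i>))\<^sup>2) / K"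
    using \<open>K > 0\<close> unfolding cayley_def norm_divide power_divide K_def[symmetric]
    by (simp add: diff_divide_distrib)
  also have "K - (cmod (w - \<i>))\<^sup>2 = 4 * Im w"
    unfolding K_def cmod_power2 by (simp add: power2_eq_square algebra_simps)
  finally have 1: "1 - (cmod (cayley w))\<^sup>2 = 4 * Im w / K" .
  have "cayley (of_real s) - cayley w = 2 * \<i> * (of_real s - w) / ((of_real s + \<i>) * (w + \<i>))"
    using nz by (simp add: cayley_def divide_simps) (simp add: algebra_simps)
  moreover have "(cmod (of_real s + \<i>))\<^sup>2 = 1 + s\<^sup>2"
    unfolding cmod_power2 by simp
  ultimately have 2: "(cmod (cayley (of_real s) - cayley w))\<^sup>2 = 4 * (cmod (of_real s - w))\<^sup>2 / ((1 + s\<^sup>2) * K)"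
    by (simp add: K_def norm_divide norm_mult power_divide power_mult_distrib)
  have "1 + s\<^sup>2 > 0"
    by (simp add: add_pos_nonneg)
  with \<open>K > 0\<close> nz show ?thesis
    unfolding 1 2 by (simp add: field_simps)
qed

section \<open>Purely atomic Clark measures\<close>

text \<open>The windows increase to all integers, so monotone convergence identifies the limit of
  partial sums with the integral over counting measure.\<close>

lemma nn_integral_count_space_int:
  fixes g :: "int \<Rightarrow> real"
  assumes nonneg: "\<And>k. 0 \<le> g k" and lim: "(\<lambda>m. \<Sum>k\<in>{- int m..<int m}. g k) \<longlonglongrightarrow> L"
  shows "(\<integral>\<^sup>+k. ennreal (g k) \<partial>count_space UNIV) = ennreal L"
proof -
  let ?I = "\<lambda>m::nat. {- int m..<int m}"
  let ?f = "\<lambda>m k. ennreal (g k) * indicator (?I m) k"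
  have inc: "incseq ?f"
    by (auto simp: incseq_def le_fun_def split: split_indicator)
  have int: "(\<integral>\<^sup>+k. ?f m k \<partial>count_space UNIV) = ennreal (\<Sum>k\<in>?I m. g k)" for m
  proof -
    have "(\<integral>\<^sup>+k. ?f m k \<partial>count_space UNIV) = (\<Sum>k\<in>?I m. ?f m k)"
      by (rule nn_integral_count_space') auto
    also have "\<dots> = (\<Sum>k\<in>?I m. ennreal (g k))"
      by (intro sum.cong) auto
    finally show ?thesis
      by (simp add: sum_ennreal nonneg)
  qed
  have sup: "(SUP m. ?f m k) = ennreal (g k)" for k
  proof (rule antisym)
    show "(SUP m. ?f m k) \<le> ennreal (g k)"
      by (intro SUP_least) (auto split: split_indicator)
    \<comment> \<open>The right end of the window is excluded, hence the \<open>+ 1\<close>.\<close>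
    have "k \<in> ?I (nat \<bar>k\<bar> + 1)" by auto
    then have "?f (nat \<bar>k\<bar> + 1) k = ennreal (g k)" by simp
    then show "ennreal (g k) \<le> (SUP m. ?f m k)"
      by (metis (mono_tags, lifting) SUP_upper UNIV_I)
  qed
  have "(\<integral>\<^sup>+k. ennreal (g k) \<partial>count_space UNIV) = (SUP m. \<integral>\<^sup>+k. ?f m k \<partial>count_space UNIV)"
    using nn_integral_monotone_convergence_SUP[OF inc, of "count_space UNIV"] by (simp add: sup)
  also have "\<dots> = (SUP m. ennreal (\<Sum>k\<in>?I m. g k))"
    by (simp only: int)
  also have "\<dots> = ennreal L"
  proof (rule LIMSEQ_unique)
    show "(\<lambda>m. ennreal (\<Sum>k\<in>?I m. g k)) \<longlonglongrightarrow> ennreal L"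
      by (rule tendsto_ennrealI[OF lim])
    show "(\<lambda>m. ennreal (\<Sum>k\<in>?I m. g k)) \<longlonglongrightarrow> (SUP m. ennreal (\<Sum>k\<in>?I m. g k))"
      by (intro LIMSEQ_SUP incseq_SucI ennreal_leI sum_mono2) (auto simp: nonneg)
  qed
  finally show ?thesis .
qed

text \<open>Written as the image of a weighted counting measure so that the rules for
  \<open>distr\<close> and \<open>density\<close> turn integrals into sums over the
  integers.\<close>

definition atomic_circle_measure :: "(int \<Rightarrow> real) \<Rightarrow> real \<Rightarrow> complex measure" where
  "atomic_circle_measure s c =
     distr (density (count_space UNIV) (\<lambda>k. ennreal (c / (1 + (s k)\<^sup>2))))
       (restrict_space borel (sphere 0 1)) (\<lambda>k. cayley (of_real (s k)))"

lemma sets_atomic_circle_measure [simp]: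
  "sets (atomic_circle_measure s c) = sets (restrict_space borel (sphere 0 1))"
  by (simp add: atomic_circle_measure_def)

lemma nn_integral_atomic_circle_measure:
  assumes "f \<in> borel_measurable borel"
  shows "(\<integral>\<^sup>+z. f z \<partial>atomic_circle_measure s c) =
    (\<integral>\<^sup>+k. ennreal (c / (1 + (s k)\<^sup>2)) * f (cayley (of_real (s k))) \<partial>count_space UNIV)"
  unfolding atomic_circle_measure_def
  using measurable_restrict_space1[OF assms]
  by (subst nn_integral_distr)
     (auto simp: nn_integral_density space_restrict_space cmod_cayley_of_real)

text \<open>The mass is the sum of the strictly positive weights of those \<open>k\<close> with
  \<open>s k = t\<close>, by injectivity of the Cayley transform on the line.\<close>

lemma emeasure_atomic_circle_measure_neq_0:
  assumes "c > 0"
  shows "emeasure (atomic_circle_measure s c) {cayley (of_real t)} \<noteq> 0 \<longleftrightarrow> t \<in> range s"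
proof -
  have "emeasure (atomic_circle_measure s c) {cayley (of_real t)} =
      (\<integral>\<^sup>+z. indicator {cayley (of_real t)} z \<partial>atomic_circle_measure s c)"
    by (rule nn_integral_indicator[symmetric])
       (auto simp: sets_restrict_space cmod_cayley_of_real intro!: image_eqI[of _ _ "{cayley (of_real t)}"])
  also have "\<dots> = (\<integral>\<^sup>+k. ennreal (c / (1 + (s k)\<^sup>2)) * indicator {cayley (of_real t)} (cayley (of_real (s k))) \<partial>count_space UNIV)"
    by (rule nn_integral_atomic_circle_measure) simp
  finally have eq: "emeasure (atomic_circle_measure s c) {cayley (of_real t)} = \<dots>" .
  have "c / (1 + (s k)\<^sup>2) > 0" for k
    using assms by (simp add: add_pos_nonneg)
  then show ?thesis
    unfolding eq by (subst nn_integral_0_iff_AE)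
      (auto simp: AE_count_space cayley_of_real_eq_iff indicator_def ennreal_eq_0_iff not_le)
qed

text \<open>The weight \<open>c / (1 + (s k)\<^sup>2)\<close> cancels the factor relating the two
  Poisson kernels, so the defining identity on the disk becomes the half-plane sum in the hypothesis
  \<open>lim\<close>.\<close>

lemma is_clark_disk_atomic_circle_measure:
  assumes "c \<ge> 0"
    and lim: "\<And>w. Im w > 0 \<Longrightarrow>
      (\<lambda>m. \<Sum>k\<in>{- int m..<int m}. c * (Im w / (cmod (of_real (s k) - w))\<^sup>2))
        \<longlonglongrightarrow> Re ((1 + F w) / (1 - F w))"
  shows "is_clark_disk (F \<circ> inv_into upper_half_plane cayley) (atomic_circle_measure s c)"
  unfolding is_clark_disk_def
proof (intro conjI ballI)
  fix \<zeta> :: complex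
  assume \<zeta>: "\<zeta> \<in> ball 0 1"
  define w where "w = inv_into upper_half_plane cayley \<zeta>"
  have w: "Im w > 0" "cayley w = \<zeta>"
    using cayley_inv_into[OF \<zeta>] by (simp_all add: w_def)
  let ?P = "\<lambda>z. (1 - (cmod \<zeta>)\<^sup>2) / (cmod (z - \<zeta>))\<^sup>2"
  have pos: "?P z \<ge> 0" for z
    using \<zeta> by (simp add: power_le_one)
  have meas: "?P \<in> borel_measurable borel"
    by measurable
  have term_eq: "ennreal (c / (1 + (s k)\<^sup>2)) * ennreal (?P (cayley (of_real (s k)))) =
      ennreal (c * (Im w / (cmod (of_real (s k) - w))\<^sup>2))" for k
  proof -
    have "1 + (s k)\<^sup>2 > 0"
      by (simp add: add_pos_nonneg)
    then have "c / (1 + (s k)\<^sup>2) * ?P (cayley (of_real (s k))) = c * (Im w / (cmod (of_real (s k) - w))\<^sup>2)"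
      using poisson_kernel_cayley[OF w(1), of "s k"] w(2) by simp
    then show ?thesis
      using \<open>1 + (s k)\<^sup>2 > 0\<close> \<open>c \<ge> 0\<close> by (simp only: ennreal_mult'[symmetric] pos divide_nonneg_pos)
  qed
  \<comment> \<open>Nonnegativity is needed to pass from \<open>ennreal\<close> back to reals, since
    \<open>ennreal\<close> sends negative numbers to 0.\<close>
  have L0: "Re ((1 + F w) / (1 - F w)) \<ge> 0"
    by (rule LIMSEQ_le_const[OF lim[OF w(1)]]) (use w(1) \<open>c \<ge> 0\<close> in \<open>auto intro!: sum_nonneg\<close>)
  have "(\<integral>\<^sup>+z. ennreal (?P z) \<partial>atomic_circle_measure s c) =
      (\<integral>\<^sup>+k. ennreal (c * (Im w / (cmod (of_real (s k) - w))\<^sup>2)) \<partial>count_space UNIV)"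
    using meas by (subst nn_integral_atomic_circle_measure) (simp_all add: term_eq)
  also have "\<dots> = ennreal (Re ((1 + F w) / (1 - F w)))"
    by (rule nn_integral_count_space_int) (use w(1) \<open>c \<ge> 0\<close> lim in auto)
  finally have "has_bochner_integral (atomic_circle_measure s c) ?P (Re ((1 + F w) / (1 - F w)))"
    using measurable_restrict_space1[OF meas] pos L0
    by (intro has_bochner_integral_nn_integral) (simp_all add: measurable_cong_sets[OF sets_atomic_circle_measure refl])
  then show "has_bochner_integral (atomic_circle_measure s c) ?P
      (Re ((1 + (F \<circ> inv_into upper_half_plane cayley) \<zeta>) / (1 - (F \<circ> inv_into upper_half_plane cayley) \<zeta>)))"
    by (simp add: w_def)
qed simp

section \<open>Transfer of point masses to the real line\<close>

text \<open>\<open>measure_of\<close> falls back to the zero measure unless the set function is a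
  measure. Countable additivity holds because the Cayley transform is injective on the line and maps
  Borel sets to measurable sets.\<close>

lemma emeasure_cayley_pullback:
  assumes M: "sets M = sets (restrict_space borel (sphere 0 1))" and A: "A \<in> sets borel"
  shows "emeasure (cayley_pullback M) A = emeasure M ((\<lambda>t. cayley (of_real t)) ` A)"
proof -
  let ?\<gamma> = "\<lambda>t::real. cayley (of_real t)"
  have image_sets: "?\<gamma> ` B \<in> sets M" if "B \<in> sets borel" for B
  proof -
    \<comment> \<open>The image of \<open>B\<close> is the preimage under the inverse transform. The
      point 1 must be removed because division by zero gives \<open>?h 1 = 0\<close>.\<close>
    let ?h = "\<lambda>z. Re (\<i> * (1 + z) / (1 - z))"
    have "?h \<in> borel_measurable borel"
      by measurable
    from measurable_sets[OF this that]
    have "?h -` B - {1} \<in> sets borel"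
      by (intro sets.Diff) simp_all
    moreover have "?\<gamma> ` B = sphere 0 1 \<inter> (?h -` B - {1})"
    proof (intro equalityI subsetI)
      fix z assume "z \<in> ?\<gamma> ` B"
      then obtain t where t: "t \<in> B" "z = ?\<gamma> t" by blast
      have "complex_of_real t \<noteq> - \<i>" by (simp add: complex_eq_iff)
      then show "z \<in> sphere 0 1 \<inter> (?h -` B - {1})"
        using t inverse_cayley[of "of_real t"]
        by (simp add: cmod_cayley_of_real cayley_of_real_neq_1)
    next
      fix z assume z: "z \<in> sphere 0 1 \<inter> (?h -` B - {1})"
      then have "?\<gamma> (?h z) = z"
        by (intro cayley_of_real_Re_inverse) auto
      with z show "z \<in> ?\<gamma> ` B"
        by (metis (no_types, lifting) DiffD1 IntE image_eqI vimageE)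
    qed
    ultimately show ?thesis
      unfolding M sets_restrict_space by blast
  qed
  have inj: "inj ?\<gamma>"
    by (simp add: inj_def cayley_of_real_eq_iff)
  show ?thesis
    unfolding cayley_pullback_def
  proof (rule emeasure_measure_of_sigma[OF _ _ _ A])
    show "sigma_algebra UNIV (sets (borel :: real measure))"
      by (metis sets.sigma_algebra_axioms space_borel)
    show "positive (sets borel) (\<lambda>A. emeasure M (?\<gamma> ` A))"
      by (simp add: positive_def)
    show "countably_additive (sets borel) (\<lambda>A. emeasure M (?\<gamma> ` A))"
    proof (rule countably_additiveI)
      fix B :: "nat \<Rightarrow> real set"
      assume B: "range B \<subseteq> sets borel" "disjoint_family B"
      have "disjoint_family (\<lambda>i. ?\<gamma> ` B i)"
        using B(2) inj by (simp add: disjoint_family_on_def image_Int[symmetric])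
      then show "(\<Sum>i. emeasure M (?\<gamma> ` B i)) = emeasure M (?\<gamma> ` (\<Union>i. B i))"
        using B(1) by (subst suminf_emeasure) (auto simp: image_UN intro!: image_sets)
    qed
  qed
qed

text \<open>The density is strictly positive, so it neither creates nor removes point
  masses.\<close>

lemma emeasure_clark_line_neq_0:
  assumes M: "sets (clark_disk (F \<circ> inv_into upper_half_plane cayley)) = sets (restrict_space borel (sphere 0 1))"
  shows "emeasure (clark_line F) {s} \<noteq> 0 \<longleftrightarrow>
    emeasure (clark_disk (F \<circ> inv_into upper_half_plane cayley)) {cayley (of_real s)} \<noteq> 0"
proof -
  define N where "N = cayley_pullback (clark_disk (F \<circ> inv_into upper_half_plane cayley))"
  have sets: "sets N = sets borel"
    using sets.sigma_sets_eq[of "borel :: real measure"] by (simp add: N_def cayley_pullback_def)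
  let ?d = "\<lambda>t::real. ennreal (1 / (pi * (1 + t\<^sup>2)))"
  have meas: "?d \<in> borel_measurable N"
    unfolding measurable_cong_sets[OF sets refl] by measurable
  have "emeasure (clark_line F) {s} = (\<integral>\<^sup>+t. ?d t * indicator {s} t \<partial>N)"
    unfolding clark_line_def N_def[symmetric] using meas by (rule emeasure_density) (simp add: sets)
  also have "\<dots> = (\<integral>\<^sup>+t. ?d s * indicator {s} t \<partial>N)"
    by (intro nn_integral_cong) (auto split: split_indicator)
  also have "\<dots> = ?d s * emeasure N {s}"
    by (rule nn_integral_cmult_indicator) (simp add: sets)
  also have "emeasure N {s} = emeasure (clark_disk (F \<circ> inv_into upper_half_plane cayley)) {cayley (of_real s)}"
    unfolding N_def by (subst emeasure_cayley_pullback[OF M]) simp_all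
  finally have "emeasure (clark_line F) {s} = ?d s * \<dots>" .
  moreover have "pi * (1 + s\<^sup>2) > 0"
    by (simp add: add_pos_nonneg)
  ultimately show ?thesis
    by (simp add: ennreal_eq_0_iff)
qed

section \<open>The characteristic function and its Clark ratio\<close>

text \<open>The parameter \<open>b\<close> covers both inner products in \<open>livsic\<close>, with
  \<open>b = 1\<close> and \<open>b = - 1\<close>; the integrand is a single exponential with rate
  \<open>- \<i> * (w - \<i> * b)\<close>.\<close>

lemma L2_inner_exp:
  assumes "a > 0" and w: "w - \<i> * of_real b \<noteq> 0"
  shows "L2_inner a (\<lambda>x. exp (- \<i> * w * of_real x)) (\<lambda>x. of_real (exp (- b * x))) =
    2 * sin ((w - \<i> * of_real b) * of_real a) / (w - \<i> * of_real b)"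
proof -
  define c where "c = - \<i> * (w - \<i> * of_real b)"
  have "c \<noteq> 0" using w by (simp add: c_def)
  have eq: "exp (- \<i> * w * of_real x) * cnj (of_real (exp (- b * x))) = exp (c * of_real x)" for x
    unfolding complex_cnj_complex_of_real unfolding exp_of_real[symmetric] exp_add[symmetric]
    by (rule arg_cong[where f = exp]) (simp add: c_def algebra_simps)
  have der: "((\<lambda>x. exp (c * of_real x) / c) has_vector_derivative exp (c * of_real x)) (at x within S)" for x S
    using \<open>c \<noteq> 0\<close> by (auto intro!: derivative_eq_intros has_vector_derivative_real_field)
  have "L2_inner a (\<lambda>x. exp (- \<i> * w * of_real x)) (\<lambda>x. of_real (exp (- b * x))) =
      (LBINT x=- a..a. exp (c * of_real x))"
    using \<open>a > 0\<close> unfolding L2_inner_def eq by (simp add: interval_lebesgue_integral_def)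
  also have "\<dots> = exp (c * of_real a) / c - exp (c * of_real (- a)) / c"
    by (rule interval_integral_FTC_finite) (use der in \<open>auto intro!: continuous_intros\<close>)
  also have "\<dots> = 2 * sin ((w - \<i> * of_real b) * of_real a) / (w - \<i> * of_real b)"
  proof -
    define d where "d = w - \<i> * of_real b"
    show ?thesis
      using w unfolding sin_exp_eq c_def d_def[symmetric]
      by (simp add: divide_simps mult_ac)
  qed
  finally show ?thesis .
qed

lemma livsic_eq:
  assumes "a > 0" "Im w > 0"
  shows "livsic a w = sin ((w - \<i>) * of_real a) / sin ((w + \<i>) * of_real a)"
\<comment> \<open>At \<open>w = \<i>\<close> the inner product formula would divide by zero, but
  there both sides are 0.\<close>
proof (cases "w = \<i>")
  case True
  then show ?thesis by (simp add: livsic_def)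
next
  case False
  have w: "w - \<i> * of_real 1 \<noteq> 0" "w - \<i> * of_real (- 1) \<noteq> 0"
    using assms False by (auto simp: complex_eq_iff)
  show ?thesis
    using L2_inner_exp[OF assms(1) w(1)] L2_inner_exp[OF assms(1) w(2)] w
    by (simp add: livsic_def)
qed

lemma sin_neq_0_of_Im_neq_0:
  assumes "Im z \<noteq> 0"
  shows "sin z \<noteq> 0"
  using assms by (auto simp: sin_eq_0)

text \<open>Expanding the quotient by \<open>sin q\<close> lets \<open>k * sin q = sin p\<close>
  eliminate \<open>k\<close>, and the addition theorem does the rest. As \<open>q = cnj p\<close>,
  the product \<open>sin p * sin q\<close> and \<open>sin (p + q)\<close> are real, while
  \<open>sin (p - q)\<close> is imaginary.\<close>

lemma Re_clark_ratio:
  fixes a \<theta> :: real and k u :: complex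
  assumes "a > 0" and k: "k * sin (of_real \<theta> - \<i> * of_real a) = sin (of_real \<theta> + \<i> * of_real a)"
    and u: "Im u > 0"
  shows "Re ((1 + sin (u - \<i> * of_real a) / sin (u + \<i> * of_real a) * k) /
             (1 - sin (u - \<i> * of_real a) / sin (u + \<i> * of_real a) * k)) =
    - (2 * (cmod (sin (of_real \<theta> + \<i> * of_real a)))\<^sup>2 / sinh (2 * a)) * Im (cot (u - of_real \<theta>))"
proof -
  define p q v where "p = of_real \<theta> + \<i> * of_real a" and "q = of_real \<theta> - \<i> * of_real a"
    and "v = u - of_real \<theta>"
  define N D where "N = sin (v + p) + k * sin (v + q)" and "D = sin (v + p) - k * sin (v + q)"
  have ua: "u + \<i> * of_real a = v + p" "u - \<i> * of_real a = v + q"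
    by (simp_all add: p_def q_def v_def)
  have kq: "k * sin q = sin p"
    using k by (simp add: p_def q_def)
  have nz: "sin v \<noteq> 0" "sin q \<noteq> 0" "sin (v + p) \<noteq> 0"
    using u \<open>a > 0\<close> by (auto intro!: sin_neq_0_of_Im_neq_0 simp: v_def q_def p_def)
  have S: "sin (p - q) = \<i> * of_real (sinh (2 * a))"
    by (simp add: p_def q_def complex_eq_iff Re_sin Im_sin sinh_field_def)
  have "sin q * D = sin q * sin (v + p) - (k * sin q) * sin (v + q)"
    by (simp add: D_def algebra_simps)
  also have "\<dots> = - sin v * sin (p - q)"
    unfolding kq sin_add sin_diff by (simp add: algebra_simps)
  finally have D: "sin q * D = - sin v * (\<i> * of_real (sinh (2 * a)))"
    unfolding S .
  have "sin q * N = sin q * sin (v + p) + (k * sin q) * sin (v + q)"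
    by (simp add: N_def algebra_simps)
  also have "\<dots> = sin v * sin (p + q) + 2 * cos v * (sin p * sin q)"
    unfolding kq sin_add by (simp add: algebra_simps)
  also have "sin p * sin q = of_real ((cmod (sin p))\<^sup>2)"
    unfolding complex_norm_square by (simp add: p_def q_def cnj_sin)
  also have "sin (p + q) = of_real (sin (2 * \<theta>))"
    by (simp add: p_def q_def sin_of_real[symmetric])
  finally have N: "sin q * N = sin v * of_real (sin (2 * \<theta>)) + 2 * cos v * of_real ((cmod (sin p))\<^sup>2)" .
  have sh: "sinh (2 * a) > 0" using \<open>a > 0\<close> by simp
  have "(1 + sin (v + q) / sin (v + p) * k) / (1 - sin (v + q) / sin (v + p) * k) = N / D"
  proof -
    have "1 + sin (v + q) / sin (v + p) * k = N / sin (v + p)" "1 - sin (v + q) / sin (v + p) * k = D / sin (v + p)"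
      using nz by (simp_all add: N_def D_def field_simps)
    then show ?thesis using nz by simp
  qed
  also have "\<dots> = (sin q * N) / (sin q * D)"
    using nz by simp
  \<comment> \<open>The first summand is real, so after multiplication by \<open>\<i>\<close> it
    drops out of the real part; the second contributes \<open>- Im (cot v)\<close> times a positive
    constant.\<close>
  also have "\<dots> = \<i> * (of_real (sin (2 * \<theta>) / sinh (2 * a)) + of_real (2 * (cmod (sin p))\<^sup>2 / sinh (2 * a)) * cot v)"
    unfolding N D using nz sh by (simp add: cot_def divide_simps algebra_simps)
  finally show ?thesis
    unfolding ua v_def[symmetric] p_def[symmetric] by simp
qed

text \<open>Expanded by the addition theorem, the claim is the tangent equation for \<theta> with
  denominators cleared. For \<open>\<alpha> = 1\<close> the angle is \<open>pi / 2\<close> and both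
  sides equal \<open>cos (\<i> * a)\<close>.\<close>

lemma arctan_ext_clark_arg:
  fixes a :: real and \<alpha> :: complex
  assumes "a > 0" "cmod \<alpha> = 1"
  defines "\<theta> \<equiv> arctan_ext (clark_arg a \<alpha>)"
  shows "cnj \<alpha> * sin (of_real \<theta> - \<i> * of_real a) = sin (of_real \<theta> + \<i> * of_real a)"
proof (cases "\<alpha> = 1")
  case True
  then have "\<theta> = pi / 2"
    by (simp add: \<theta>_def clark_arg_def arctan_ext_def)
  then have "sin \<theta> = 1" "cos \<theta> = 0"
    by (simp_all only: sin_pi_half cos_pi_half)
  then have "sin (complex_of_real \<theta>) = 1" "cos (complex_of_real \<theta>) = 0"
    by (simp_all add: sin_of_real cos_of_real)
  then show ?thesis
    using True by (simp add: sin_add sin_diff)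
next
  case False
  define k where "k = cnj \<alpha>"
  have "k \<noteq> 1"
    using False by (metis k_def complex_cnj_cnj complex_cnj_one)
  let ?z = "(k + 1) / (k - 1) * tan (\<i> * of_real a)"
  have \<theta>: "\<theta> = arctan (Re ?z)"
    using False by (simp add: \<theta>_def clark_arg_def arctan_ext_def k_def)
  \<comment> \<open>The \<open>Re\<close> in \<open>clark_arg\<close> is lossless, the number being
    real.\<close>
  have z: "of_real (Re ?z) = ?z"
    using clark_arg_real[OF assms(2), of a] unfolding k_def by (rule of_real_Re)
  have "sin \<theta> = cos \<theta> * Re ?z"
    using cos_arctan_not_zero[of "Re ?z"] tan_arctan[of "Re ?z"] unfolding \<theta> tan_def
    by (simp add: field_simps)
  then have s: "sin (complex_of_real \<theta>) = cos (of_real \<theta>) * ?z"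
    by (metis of_real_mult z sin_of_real cos_of_real)
  have "Re (cos (\<i> * complex_of_real a)) > 0"
    by (simp add: Re_cos add_pos_pos)
  then have "cos (\<i> * complex_of_real a) \<noteq> 0"
    by auto
  then have "(k - 1) * sin (of_real \<theta>) * cos (\<i> * of_real a) = (k + 1) * cos (of_real \<theta>) * sin (\<i> * of_real a)"
    using \<open>k \<noteq> 1\<close> unfolding s by (simp add: tan_def)
  then show ?thesis
    unfolding k_def[symmetric] sin_add sin_diff by (simp add: algebra_simps)
qed

section \<open>Identification of the atoms\<close>

theorem theorem16:
  fixes a :: real and \<alpha> :: complex
  assumes "0 < a" and "cmod \<alpha> = 1"
  shows "{s. emeasure (clark_line (\<lambda>w. livsic a w * cnj \<alpha>)) {s} \<noteq> 0} = clark_points a \<alpha>"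
proof -
  define \<theta> where "\<theta> = arctan_ext (clark_arg a \<alpha>)"
  define C where "C = 2 * (cmod (sin (of_real \<theta> + \<i> * of_real a)))\<^sup>2 / sinh (2 * a)"
  \<comment> \<open>The sign of \<open>k\<close> is opposite to that of \<open>n\<close> in
    \<open>clark_points\<close>, so that \<open>z + k\<close> below is a real multiple of
    \<open>s k - w\<close>.\<close>
  define s where "s k = (\<theta> - of_int k * pi) / a" for k :: int
  define F where "F = (\<lambda>w. livsic a w * cnj \<alpha>)"
  have "C > 0"
    using \<open>0 < a\<close> sin_neq_0_of_Im_neq_0[of "of_real \<theta> + \<i> * of_real a"] by (simp add: C_def)
  have "(\<lambda>m. \<Sum>k\<in>{- int m..<int m}. C / a * (Im w / (cmod (of_real (s k) - w))\<^sup>2))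
      \<longlonglongrightarrow> Re ((1 + F w) / (1 - F w))" if w: "Im w > 0" for w
  proof -
    \<comment> \<open>\<open>z\<close> is scaled so that \<open>pi * z = a * w - \<theta>\<close>,
      which puts the poles of the cotangent at integers.\<close>
    define u z where "u = of_real a * w" and "z = (u - of_real \<theta>) / of_real pi"
    have Im: "Im u = a * Im w" "Im z = a / pi * Im w"
      by (simp_all add: u_def z_def)
    then have pos: "Im u > 0" "Im z > 0"
      using w \<open>0 < a\<close> by simp_all
    have F: "F w = sin (u - \<i> * of_real a) / sin (u + \<i> * of_real a) * cnj \<alpha>"
      using livsic_eq[OF \<open>0 < a\<close> w] by (simp add: F_def u_def algebra_simps)
    have Re: "Re ((1 + F w) / (1 - F w)) = - C * Im (cot (u - of_real \<theta>))"
      unfolding F C_def \<theta>_def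
      by (rule Re_clark_ratio[OF \<open>0 < a\<close> arctan_ext_clark_arg[OF assms] pos(1)])
    \<comment> \<open>\<open>Im z\<close> carries one factor \<open>a / pi\<close> and the squared
      modulus two, which turns \<open>C / pi\<close> into the mass constant
      \<open>C / a\<close>.\<close>
    have "C / a * (Im w / (cmod (of_real (s k) - w))\<^sup>2) = C / pi * (Im z / (cmod (z + of_int k))\<^sup>2)" for k
    proof -
      have "z + of_int k = of_real (- (a / pi)) * (of_real (s k) - w)"
        using \<open>0 < a\<close> by (simp add: z_def u_def s_def field_simps)
      then have "(cmod (z + of_int k))\<^sup>2 = (a / pi)\<^sup>2 * (cmod (of_real (s k) - w))\<^sup>2"
        by (simp only: norm_mult norm_of_real power_mult_distrib power2_abs power2_minus)
      then show ?thesis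
        using \<open>0 < a\<close> by (simp add: Im power2_eq_square)
    qed
    moreover have "(\<lambda>m. C / pi * (\<Sum>k\<in>{- int m..<int m}. Im z / (cmod (z + of_int k))\<^sup>2))
        \<longlonglongrightarrow> C / pi * (- pi * Im (cot (of_real pi * z)))"
      by (intro tendsto_mult tendsto_const Im_cot_partial_fractions pos)
    moreover have "of_real pi * z = u - of_real \<theta>"
      by (simp add: z_def)
    ultimately show ?thesis
      by (simp add: Re sum_distrib_left)
  qed
  then have clark: "is_clark_disk (F \<circ> inv_into upper_half_plane cayley) (atomic_circle_measure s (C / a))"
    using \<open>C > 0\<close> \<open>0 < a\<close> by (intro is_clark_disk_atomic_circle_measure) simp_all
  \<comment> \<open>Existence and uniqueness together resolve the \<open>THE\<close> in
    \<open>clark_disk\<close>.\<close>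
  then have eq: "clark_disk (F \<circ> inv_into upper_half_plane cayley) = atomic_circle_measure s (C / a)"
    unfolding clark_disk_def by (rule the_equality) (rule is_clark_disk_unique[OF _ clark])
  have "emeasure (clark_line F) {t} \<noteq> 0 \<longleftrightarrow> t \<in> range s" for t
    using emeasure_clark_line_neq_0[of F t] emeasure_atomic_circle_measure_neq_0[of "C / a" s t]
      \<open>C > 0\<close> \<open>0 < a\<close> by (simp add: eq)
  moreover have "range s = clark_points a \<alpha>"
  proof (intro equalityI subsetI)
    fix t assume "t \<in> range s"
    then obtain k where "t = s k" by blast
    then have "t = 1 / a * \<theta> + of_int (- k) * pi / a"
      by (simp add: s_def diff_divide_distrib)
    then show "t \<in> clark_points a \<alpha>"
      unfolding clark_points_def \<theta>_def by blast
  next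
    fix t assume "t \<in> clark_points a \<alpha>"
    then obtain n :: int where "t = 1 / a * \<theta> + of_int n * pi / a"
      unfolding clark_points_def \<theta>_def by blast
    then have "t = s (- n)"
      by (simp add: s_def add_divide_distrib)
    then show "t \<in> range s" by blast
  qed
  ultimately show ?thesis
    by (auto simp: F_def)
qed

end
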